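(* For every fixed $\mathcal{L} \in \mathbb{N}$, $\mathcal{L}\ge 1$, the scheduling problem $1|mc=\mathcal{L},mu|C_{\max}$ is contained in the complexity class $\mathcal{APX}$; that is, there exist a constant $c \geq 1$ (which may depend on $\mathcal{L}$) and a polynomial-time algorithm which, for every instance $I_{\mathcal{MC}}$ of $1|mc=\mathcal{L},mu|C_{\max}$, outputs a feasible schedule whose makespan is at most $c \cdot OPT(I_{\mathcal{MC}})$, where $OPT(I_{\mathcal{MC}})$ denotes the minimum makespan over all feasible schedules for $I_{\mathcal{MC}}$.
   Context: An F-shape (F-shaped task) $T_i$ is a pair $(\mathcal{X}_i, \mathbf{P}_i)$ where $\mathcal{X}_i \in \{1,\ldots,\mathcal{L}\}$ is the criticality of the task and $\mathbf{P}_i = (p_i^{(1)}, \ldots, p_i^{(\mathcal{X}_i)})$ is a vector of $\mathcal{X}_i$ positive integers (processing times) with $p_i^{(1)} < p_i^{(2)} < \cdots < p_i^{(\mathcal{X}_i)}$. An instance of $1|mc=\mathcal{L},mu|C_{\max}$ is a finite collection $I_{\mathcal{MC}} = \{T_1,\ldots,T_n\}$ of F-shaped tasks with criticalities at most $\mathcal{L}$ (distinct tasks may have equal data). A schedule is an assignment $(s_1,\ldots,s_n)$ of nonnegative integer start times. It is feasible if and only if for all $i \neq j$ in $\{1,\ldots,n\}$: $$\left(s_i + p_i^{(\min\{\mathcal{X}_i,\mathcal{X}_j\})} \leq s_j\right) \vee \left(s_j + p_j^{(\min\{\mathcal{X}_i,\mathcal{X}_j\})} \leq s_i\right).$$ The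 makespan of a schedule is $\max_i \left(s_i + p_i^{(\mathcal{X}_i)}\right)$. The problem $1|mc=\mathcal{L},mu|C_{\max}$ is to find a feasible schedule of minimum makespan. *)

theory Defs
  imports Complex_Main "HOL-Computational_Algebra.Polynomial"
begin

section \<open>F-shaped tasks, instances and schedules\<close>

text \<open>A task is a pair of its criticality and its vector of processing times.\<close>

type_synonym task = "nat \<times> nat list"

abbreviation crit :: "task \<Rightarrow> nat" where
  "crit T \<equiv> fst T"

text \<open>Processing times are numbered from 1, list positions from 0.\<close>

definition ptime :: "task \<Rightarrow> nat \<Rightarrow> nat" where
  "ptime T k = snd T ! (k - 1)"

definition fshape :: "nat \<Rightarrow> task \<Rightarrow> bool" where
  "fshape L T \<longleftrightarrow>
     1 \<le> crit T \<and> crit T \<le> L \<and> length (snd T) = crit T \<and>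
     (\<forall>k\<in>{1..crit T}. 0 < ptime T k) \<and>
     (\<forall>k. 1 \<le> k \<and> k < crit T \<longrightarrow> ptime T k < ptime T (k + 1))"

text \<open>Instances are lists, since distinct tasks may have equal data.\<close>

definition instances :: "nat \<Rightarrow> task list set" where
  "instances L = {I. \<forall>T\<in>set I. fshape L T}"

type_synonym schedule = "nat list"

definition feasible :: "task list \<Rightarrow> schedule \<Rightarrow> bool" where
  "feasible I s \<longleftrightarrow>
     length s = length I \<and>
     (\<forall>i<length I. \<forall>j<length I. i \<noteq> j \<longrightarrow>
        (let m = min (crit (I ! i)) (crit (I ! j)) in
           s ! i + ptime (I ! i) m \<le> s ! j \<or> s ! j + ptime (I ! j) m \<le> s ! i))"

text \<open>The inserted 0 matters only for the empty instance, whose makespan is thereby 0.\<close>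

definition makespan :: "task list \<Rightarrow> schedule \<Rightarrow> nat" where
  "makespan I s = Max (insert 0 {s ! i + ptime (I ! i) (crit (I ! i)) | i. i < length I})"

definition OPT :: "task list \<Rightarrow> nat" where
  "OPT I = (LEAST m. \<exists>s. feasible I s \<and> m = makespan I s)"


section \<open>Deterministic multi-tape Turing machines\<close>

text \<open>
  The states are the numbers up to and including \<open>num_states\<close>; 0 is the start state and
  \<open>num_states\<close> itself the only halting state. Tape symbols are the numbers below
  \<open>num_symbols\<close>, with 0 as the blank. The transition function maps the current state and
  the list of scanned symbols, one per tape, to the next state and, for each tape, the
  symbol to write and the head movement.
\<close>

datatype dir = MoveLeft | Stay | MoveRight

record tm =
  num_tapes :: nat
  num_symbols :: nat
  num_states :: nat
  delta :: "nat \<Rightarrow> nat list \<Rightarrow> nat \<times> (nat \<times> dir) list"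

definition wf_tm :: "tm \<Rightarrow> bool" where
  "wf_tm M \<longleftrightarrow>
     2 \<le> num_tapes M \<and> 0 < num_symbols M \<and>
     (\<forall>q syms. q < num_states M \<and> length syms = num_tapes M \<and> set syms \<subseteq> {..<num_symbols M} \<longrightarrow>
        (case delta M q syms of (q', acts) \<Rightarrow>
           q' \<le> num_states M \<and> length acts = num_tapes M \<and>
           (\<forall>(a, d)\<in>set acts. a < num_symbols M)))"

text \<open>A tape, infinite in both directions, is given by its contents and its head position.\<close>

type_synonym tape = "(int \<Rightarrow> nat) \<times> int"
type_synonym config = "nat \<times> tape list"

fun move :: "dir \<Rightarrow> int \<Rightarrow> int" where
  "move MoveLeft h = h - 1"
| "move Stay h = h"
| "move MoveRight h = h + 1"

fun act :: "nat \<times> dir \<Rightarrow> tape \<Rightarrow> tape" where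
  "act (a, d) (f, h) = (f(h := a), move d h)"

fun step :: "tm \<Rightarrow> config \<Rightarrow> config" where
  "step M (q, tps) =
     (if q = num_states M then (q, tps)
      else case delta M q (map (\<lambda>(f, h). f h) tps) of (q', acts) \<Rightarrow> (q', map2 act acts tps))"

definition contents :: "nat list \<Rightarrow> int \<Rightarrow> nat" where
  "contents w i = (if 0 \<le> i \<and> i < int (length w) then w ! nat i else 0)"

definition init :: "tm \<Rightarrow> nat list \<Rightarrow> config" where
  "init M w = (0, (contents w, 0) # replicate (num_tapes M - 1) (\<lambda>_. 0, 0))"

text \<open>The input is on the first tape and the output on the second.\<close>

definition outputs_within :: "tm \<Rightarrow> nat list \<Rightarrow> nat \<Rightarrow> nat list \<Rightarrow> bool" where
  "outputs_within M w b v \<longleftrightarrow>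
     (\<exists>t\<le>b. \<exists>tps. (step M ^^ t) (init M w) = (num_states M, tps) \<and> fst (tps ! 1) = contents v)"

definition poly_time_on ::
    "'a set \<Rightarrow> ('a \<Rightarrow> nat list) \<Rightarrow> ('b \<Rightarrow> nat list) \<Rightarrow> ('a \<Rightarrow> 'b) \<Rightarrow> bool" where
  "poly_time_on D enc enc' f \<longleftrightarrow>
     (\<exists>M (p :: nat poly). wf_tm M \<and>
        (\<forall>x\<in>D. set (enc x) \<subseteq> {..<num_symbols M} \<and>
           outputs_within M (enc x) (poly p (length (enc x))) (enc' (f x))))"


section \<open>Binary encodings of instances and schedules\<close>

text \<open>
  Symbols 1 and 2 stand for the binary digits 0 and 1, symbol 3 ends a number and symbol 4
  ends a task. Numbers are written least significant digit first, zero as the empty word.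
\<close>

fun enc_bits :: "nat \<Rightarrow> nat list" where
  "enc_bits n = (if n = 0 then [] else Suc (n mod 2) # enc_bits (n div 2))"

declare enc_bits.simps [simp del]

definition enc_num :: "nat \<Rightarrow> nat list" where
  "enc_num n = enc_bits n @ [3]"

definition enc_task :: "task \<Rightarrow> nat list" where
  "enc_task T = concat (map enc_num (crit T # snd T)) @ [4]"

definition enc_instance :: "task list \<Rightarrow> nat list" where
  "enc_instance I = concat (map enc_task I)"

definition enc_schedule :: "schedule \<Rightarrow> nat list" where
  "enc_schedule s = concat (map enc_num s)"

end

theory Submission
  imports Defs
begin

text \<open>
  Run the tasks one after another in the given order, reserving for each task the sum of all
  the numbers in its encoding. This is at most \<open>2 * L\<close> times its longest processing time. The
  longest processing times of the tasks of one criticality are occupied disjointly in every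
  feasible schedule, so they sum up to at most the optimum, and there are \<open>L\<close> criticalities.

  A Turing machine computes the start times in a single pass over the input, adding every
  number it reads to a binary accumulator and copying the accumulator to the output at the
  beginning of every task.
\<close>

section \<open>The serial schedule\<close>

text \<open>Counting the criticality lets the machine add all numbers of a task alike, at the price
  of a factor 2.\<close>

definition dur :: "task \<Rightarrow> nat" where
  "dur T = sum_list (crit T # snd T)"

fun starts :: "nat \<Rightarrow> task list \<Rightarrow> schedule" where
  "starts y [] = []"
| "starts y (T # I) = y # starts (y + dur T) I"

lemma length_starts [simp]: "length (starts y I) = length I"
  by (induction I arbitrary: y) auto

lemma nth_starts: "i < length I \<Longrightarrow> starts y I ! i = y + sum_list (map dur (take i I))"
  by (induction I arbitrary: y i) (auto simp: nth_Cons' take_Cons' gr0_conv_Suc)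

text \<open>For \<open>j < length I\<close> the right-hand side is a start time and yields
  feasibility; for \<open>j = length I\<close> it bounds the makespan.\<close>

lemma starts_add_dur_le:
  assumes "i < j" "j \<le> length I"
  shows "starts y I ! i + dur (I ! i) \<le> y + sum_list (map dur (take j I))"
proof -
  have "take j I = take (Suc i) I @ drop (Suc i) (take j I)"
    using assms by (metis append_take_drop_id less_eq_Suc_le min.absorb1 take_take)
  then have "sum_list (map dur (take (Suc i) I)) \<le> sum_list (map dur (take j I))"
    by (metis le_add1 map_append sum_list_append)
  then show ?thesis
    using assms by (simp add: nth_starts take_Suc_conv_app_nth)
qed

lemma ptime_in_set:
  assumes "fshape L T" "1 \<le> k" "k \<le> crit T"
  shows "ptime T k \<in> set (snd T)"
  using assms by (auto simp: fshape_def ptime_def)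

lemma ptime_le_dur:
  assumes "fshape L T" "1 \<le> k" "k \<le> crit T"
  shows "ptime T k \<le> dur T"
  using member_le_sum_list[OF ptime_in_set[OF assms]] by (simp add: dur_def)

lemma ptime_le_last:
  assumes "fshape L T" "1 \<le> k" "k \<le> crit T"
  shows "ptime T k \<le> ptime T (crit T)"
  using assms(3,2)
proof (induction rule: inc_induct)
  case (step n)
  moreover have "ptime T n < ptime T (n + 1)"
    using assms(1) step by (simp add: fshape_def)
  ultimately show ?case by simp
qed simp

text \<open>At most \<open>L\<close> processing times, none above the last, give one half. The
  criticality is at most \<open>L\<close> and the last processing time at least 1, which gives the
  other.\<close>

lemma dur_le:
  assumes "fshape L T"
  shows "dur T \<le> 2 * L * ptime T (crit T)"
proof -
  have len: "length (snd T) = crit T" "crit T \<le> L" "0 < ptime T (crit T)"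
    using assms by (auto simp: fshape_def)
  have "x \<le> ptime T (crit T)" if "x \<in> set (snd T)" for x
  proof -
    obtain i where "i < crit T" "x = snd T ! i"
      using \<open>x \<in> set (snd T)\<close> len by (auto simp: in_set_conv_nth)
    then show ?thesis
      using ptime_le_last[OF assms, of "Suc i"] by (simp add: ptime_def)
  qed
  then have "sum_list (snd T) \<le> sum_list (map (\<lambda>_. ptime T (crit T)) (snd T))"
    using sum_list_mono[of "snd T" "\<lambda>x. x" "\<lambda>_. ptime T (crit T)"] by simp
  also have "\<dots> = crit T * ptime T (crit T)"
    using len by (simp add: sum_list_triv)
  also have "\<dots> \<le> L * ptime T (crit T)"
    using len by simp
  finally have "sum_list (snd T) \<le> L * ptime T (crit T)" .
  moreover have "crit T \<le> L * ptime T (crit T)"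
    using len by (metis One_nat_def Suc_leI le_trans mult.right_neutral mult_le_mono)
  ultimately show ?thesis
    by (simp add: dur_def)
qed

text \<open>The reserved time covers the processing time at every level up to the criticality,
  whichever level the other task selects.\<close>

lemma feasible_starts:
  assumes "I \<in> instances L"
  shows "feasible I (starts y I)"
proof -
  have *: "starts y I ! i + ptime (I ! i) (min (crit (I ! i)) (crit (I ! j))) \<le> starts y I ! j"
    if "i < j" "j < length I" for i j
  proof -
    have "fshape L (I ! i)" "fshape L (I ! j)"
      using assms that by (auto simp: instances_def)
    then have "ptime (I ! i) (min (crit (I ! i)) (crit (I ! j))) \<le> dur (I ! i)"
      by (intro ptime_le_dur) (auto simp: fshape_def)
    then show ?thesis
      using starts_add_dur_le[of i j I y] that by (simp add: nth_starts)
  qed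
  show ?thesis
    unfolding feasible_def Let_def by (metis * length_starts linorder_neqE_nat min.commute)
qed

section \<open>Comparison of the makespan with the optimum\<close>

lemma le_makespan:
  "i < length I \<Longrightarrow> s ! i + ptime (I ! i) (crit (I ! i)) \<le> makespan I s"
  unfolding makespan_def by (rule Max_ge) auto

lemma makespan_starts_le:
  assumes "I \<in> instances L"
  shows "makespan I (starts 0 I) \<le> sum_list (map dur I)"
proof -
  have "starts 0 I ! i + ptime (I ! i) (crit (I ! i)) \<le> sum_list (map dur I)"
    if "i < length I" for i
  proof -
    have "fshape L (I ! i)"
      using assms that by (auto simp: instances_def)
    then have "ptime (I ! i) (crit (I ! i)) \<le> dur (I ! i)"
      by (intro ptime_le_dur) (auto simp: fshape_def)
    then show ?thesis
      using starts_add_dur_le[of i "length I" I 0] that by simp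
  qed
  then show ?thesis
    unfolding makespan_def by auto
qed

text \<open>Two tasks of criticality \<open>k\<close> are compared at level \<open>k\<close>, so
  feasibility keeps their full execution intervals disjoint. The bound counts the integer points in
  these intervals, all of which lie below the makespan.\<close>

lemma sum_ptime_le_makespan:
  assumes "feasible I s"
  shows "(\<Sum>i | i < length I \<and> crit (I ! i) = k. ptime (I ! i) k) \<le> makespan I s"
proof -
  let ?K = "{i. i < length I \<and> crit (I ! i) = k}"
  let ?J = "\<lambda>i. {s ! i ..< s ! i + ptime (I ! i) k}"
  have "?J i \<inter> ?J j = {}" if "i \<in> ?K" "j \<in> ?K" "i \<noteq> j" for i j
    using assms that unfolding feasible_def Let_def by fastforce
  then have "(\<Sum>i\<in>?K. ptime (I ! i) k) = card (\<Union>i\<in>?K. ?J i)"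
    by (subst card_UN_disjoint) auto
  also have "\<dots> \<le> card {..<makespan I s}"
    using le_makespan[of _ I s] by (intro card_mono) (fastforce intro: less_le_trans)+
  finally show ?thesis by simp
qed

text \<open>The factor \<open>2 * L\<close> comes from \<open>dur_le\<close>, the other
  \<open>L\<close> from splitting the tasks by criticality.\<close>

lemma sum_dur_le_makespan:
  assumes "I \<in> instances L" "feasible I s"
  shows "sum_list (map dur I) \<le> 2 * L * L * makespan I s"
proof -
  have shape: "fshape L (I ! i)" if "i < length I" for i
    using assms that by (auto simp: instances_def)
  have "sum_list (map dur I) = (\<Sum>i<length I. dur (I ! i))"
    by (simp add: sum_list_sum_nth atLeast0LessThan)
  also have "\<dots> \<le> (\<Sum>i<length I. 2 * L * ptime (I ! i) (crit (I ! i)))"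
    using shape by (intro sum_mono dur_le) auto
  also have "\<dots> = 2 * L * (\<Sum>i<length I. ptime (I ! i) (crit (I ! i)))"
    by (simp add: sum_distrib_left)
  also have "(\<Sum>i<length I. ptime (I ! i) (crit (I ! i))) =
      (\<Sum>k\<in>{1..L}. \<Sum>i | i \<in> {..<length I} \<and> crit (I ! i) = k. ptime (I ! i) (crit (I ! i)))"
    using shape by (intro sum.group[symmetric]) (auto simp: fshape_def)
  also have "\<dots> = (\<Sum>k\<in>{1..L}. \<Sum>i | i < length I \<and> crit (I ! i) = k. ptime (I ! i) k)"
    by (intro sum.cong) auto
  also have "\<dots> \<le> (\<Sum>k\<in>{1..L}. makespan I s)"
    by (intro sum_mono sum_ptime_le_makespan assms)
  finally show ?thesis by simp
qed

lemma makespan_starts_le_OPT: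
  assumes "I \<in> instances L"
  shows "makespan I (starts 0 I) \<le> 2 * L * L * OPT I"
proof -
  have "\<exists>s. feasible I s \<and> OPT I = makespan I s"
    unfolding OPT_def by (rule LeastI) (use feasible_starts[OF assms] in blast)
  then show ?thesis
    using sum_dur_le_makespan[OF assms] makespan_starts_le[OF assms] le_trans by metis
qed


section \<open>Bit lengths\<close>

lemma enc_bits_0 [simp]: "enc_bits 0 = []"
  by (simp add: enc_bits.simps)

lemma enc_bits_pos: "0 < n \<Longrightarrow> enc_bits n = Suc (n mod 2) # enc_bits (n div 2)"
  by (simp add: enc_bits.simps)

text \<open>This turns estimates of bit lengths into arithmetic with powers of 2.\<close>

lemma length_enc_bits_le_iff: "length (enc_bits n) \<le> k \<longleftrightarrow> n < 2 ^ k"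
proof (induction k arbitrary: n)
  case 0
  then show ?case by (cases "n = 0") (simp_all add: enc_bits_pos)
next
  case (Suc k)
  have "length (enc_bits n) \<le> Suc k \<longleftrightarrow> length (enc_bits (n div 2)) \<le> k"
    by (cases "n = 0") (simp_all add: enc_bits_pos)
  then show ?case
    unfolding Suc.IH by (simp add: div_less_iff_less_mult mult.commute)
qed

lemma length_enc_bits_mono: "m \<le> n \<Longrightarrow> length (enc_bits m) \<le> length (enc_bits n)"
  by (meson le_less_trans length_enc_bits_le_iff order_refl)

lemma length_enc_bits_add_le:
  "length (enc_bits (m + n)) \<le> length (enc_bits m) + length (enc_bits n) + 1"
proof -
  let ?k = "length (enc_bits m) + length (enc_bits n)"
  have "m < 2 ^ ?k" "n < 2 ^ ?k"
    by (simp_all flip: length_enc_bits_le_iff)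
  then show ?thesis
    by (simp add: length_enc_bits_le_iff)
qed

text \<open>The end symbol of each number pays for the extra bit of one addition.\<close>

lemma length_enc_bits_sum_list:
  "length (enc_bits (sum_list xs)) \<le> length (concat (map enc_num xs))"
proof (induction xs)
  case (Cons x xs)
  then show ?case
    using length_enc_bits_add_le[of x "sum_list xs"] by (simp add: enc_num_def)
qed simp

text \<open>Here the symbol that ends a task pays for the extra bit. The accumulator thus never
  outgrows the input, which keeps the running time quadratic.\<close>

lemma length_enc_bits_sum_dur:
  "length (enc_bits (sum_list (map dur I))) \<le> length (enc_instance I)"
proof (induction I)
  case (Cons T I)
  then show ?case
    using length_enc_bits_add_le[of "dur T" "sum_list (map dur I)"]
      length_enc_bits_sum_list[of "crit T # snd T"]
    by (simp add: enc_instance_def enc_task_def dur_def[of T])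
qed (simp add: enc_instance_def)

lemma set_enc_bits: "set (enc_bits n) \<subseteq> {1, 2}"
proof (induction n rule: less_induct)
  case (less n)
  then show ?case
    by (cases "n = 0") (auto simp: enc_bits_pos)
qed

lemma set_enc_num: "set (enc_num n) \<subseteq> {1, 2, 3}"
  using set_enc_bits[of n] by (auto simp: enc_num_def)

lemma set_enc_instance: "set (enc_instance I) \<subseteq> {1, 2, 3, 4}"
proof -
  have "set (enc_task T) \<subseteq> {1, 2, 3, 4}" for T
    using set_enc_num by (auto simp: enc_task_def)
  then show ?thesis
    by (auto simp: enc_instance_def)
qed


section \<open>Tapes holding words\<close>

lemma contents_nth [simp]: "contents (u @ a # v) (int (length u)) = a"
  by (simp add: contents_def)

lemma contents_end [simp]: "contents u (int (length u)) = 0"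
  by (simp add: contents_def)

lemma contents_minus_one [simp]: "contents u (- 1) = 0"
  by (simp add: contents_def)

lemma contents_snoc [simp]: "(contents u)(int (length u) := a) = contents (u @ [a])"
  by (auto simp: contents_def fun_eq_iff nth_append)

lemma contents_snoc_blank [simp]: "contents (u @ [0]) = contents u"
  by (auto simp: contents_def fun_eq_iff nth_append)

lemma contents_update [simp]: "(contents (u @ a # v))(int (length u) := b) = contents (u @ b # v)"
  by (auto simp: contents_def fun_eq_iff nth_append nth_Cons')

lemma contents_Nil: "contents [] = (\<lambda>_. 0)"
  by (auto simp: contents_def)


section \<open>The Turing machine\<close>

text \<open>
  The third tape is the accumulator. State 0 copies it to the output at the beginning of a task,
  state 1 rewinds it, states 2 and 3 add the next number to it, with carry 0 and 1 respectively.
  Truncated subtraction makes a blank on the accumulator count as the digit 0.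
\<close>

definition sched_delta :: "nat \<Rightarrow> nat list \<Rightarrow> nat \<times> (nat \<times> dir) list" where
  "sched_delta q syms = (let a = syms ! 0; b = syms ! 1; s = syms ! 2 in
     if q = 0 then
       if a = 0 then (4, [(a, Stay), (b, Stay), (s, Stay)])
       else if s = 0 then (1, [(a, Stay), (3, MoveRight), (s, MoveLeft)])
       else (0, [(a, Stay), (s, MoveRight), (s, MoveRight)])
     else if q = 1 then
       if s = 0 then (2, [(a, Stay), (b, Stay), (s, MoveRight)])
       else (1, [(a, Stay), (b, Stay), (s, MoveLeft)])
     else if a = 4 then (0, [(a, MoveRight), (b, Stay), (s, Stay)])
     else if a = 3 \<and> q = 2 then (1, [(a, MoveRight), (b, Stay), (s, MoveLeft)])
     else let d = (if a = 3 then 0 else a - 1) + (s - 1) + (q - 2) in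
       (2 + d div 2,
        [(a, if a = 3 then Stay else MoveRight), (b, Stay), (Suc (d mod 2), MoveRight)]))"

definition sched_tm :: tm where
  "sched_tm = \<lparr>num_tapes = 3, num_symbols = 5, num_states = 4, delta = sched_delta\<rparr>"

lemma wf_sched_tm: "wf_tm sched_tm"
proof -
  have "case sched_delta q syms of (q', acts) \<Rightarrow>
      q' \<le> 4 \<and> length acts = 3 \<and> (\<forall>(a, d)\<in>set acts. a < 5)"
    if "q < 4" "length syms = 3" "set syms \<subseteq> {..<5}" for q syms
  proof -
    obtain a b s where syms: "syms = [a, b, s]"
      using \<open>length syms = 3\<close> by (auto simp: length_Suc_conv numeral_eq_Suc)
    have "a < 5" "b < 5" "s < 5"
      using that syms by auto
    \<comment> \<open>Well-formedness allows any accumulator symbol below 5, so the digit sum may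
      reach 1 + 3 + 1. Its half plus 2 still does not exceed the halting state 4.\<close>
    moreover have "(if a = 3 then 0 else a - 1) + (s - 1) + (q - 2) \<le> 5" if "a \<noteq> 4"
      using \<open>q < 4\<close> \<open>a < 5\<close> \<open>s < 5\<close> that by auto
    ultimately show ?thesis
      unfolding sched_delta_def syms Let_def by auto
  qed
  then show ?thesis
    by (simp add: wf_tm_def sched_tm_def)
qed

text \<open>The output is only appended to, so its head stays at the end of \<open>v\<close>. The
  accumulator head is an integer because rewinding takes it to position -1.\<close>

definition cfg :: "nat \<Rightarrow> nat list \<Rightarrow> nat \<Rightarrow> nat list \<Rightarrow> nat list \<Rightarrow> int \<Rightarrow> config" where
  "cfg q w i v a j = (q, [(contents w, int i), (contents v, int (length v)), (contents a, j)])"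

definition reach :: "nat \<Rightarrow> config \<Rightarrow> config \<Rightarrow> bool" where
  "reach b x y \<longleftrightarrow> (\<exists>t\<le>b. (step sched_tm ^^ t) x = y)"

lemma reach_refl: "reach b x x"
  unfolding reach_def by (rule exI[of _ 0]) simp

lemma reach_trans:
  assumes "reach b x y" "reach b' y z" "b + b' \<le> c"
  shows "reach c x z"
proof -
  obtain t t' where "t \<le> b" "t' \<le> b'" "(step sched_tm ^^ t) x = y" "(step sched_tm ^^ t') y = z"
    using assms by (auto simp: reach_def)
  then have "(step sched_tm ^^ (t' + t)) x = z" "t' + t \<le> c"
    using assms(3) by (simp_all add: funpow_add)
  then show ?thesis
    unfolding reach_def by blast
qed

lemma reach_mono: "reach b x y \<Longrightarrow> b \<le> c \<Longrightarrow> reach c x y"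
  using reach_trans[OF _ reach_refl[of 0]] by simp

lemma reach_step:
  assumes "step sched_tm x = y" "reach b y z" "Suc b \<le> c"
  shows "reach c x z"
proof -
  have "reach 1 x y"
    unfolding reach_def using assms(1) by (intro exI[of _ 1]) simp
  then show ?thesis
    using reach_trans assms by (metis plus_1_eq_Suc)
qed

lemmas step_simps = cfg_def sched_tm_def sched_delta_def Let_def fun_upd_idem

text \<open>The digits are nonblank, so the head turns only at the blank left of the word. That
  position is the case \<open>j = 0\<close>, and the extra step leads from it back to 0.\<close>

lemma reach_rewind:
  assumes "0 \<notin> set a" "j \<le> length a"
  shows "reach (j + 1) (cfg 1 w i v a (int j - 1)) (cfg 2 w i v a 0)"
  using assms(2)
proof (induction j)
  case 0
  have "step sched_tm (cfg 1 w i v a (int 0 - 1)) = cfg 2 w i v a 0"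
    by (simp add: step_simps)
  then show ?case
    by (rule reach_step) (auto intro: reach_refl)
next
  case (Suc j)
  have "contents a (int j) = a ! j"
    using Suc.prems by (simp add: contents_def)
  moreover have "a ! j \<noteq> 0"
    using Suc.prems assms(1) by (metis Suc_le_lessD nth_mem)
  ultimately have "step sched_tm (cfg 1 w i v a (int (Suc j) - 1)) = cfg 1 w i v a (int j - 1)"
    by (simp add: step_simps)
  then show ?case
    by (rule reach_step) (use Suc in auto)
qed

text \<open>For the induction, \<open>a1\<close> is the part already copied. The extra step writes
  the end symbol 3 when the head meets the blank behind the accumulator.\<close>

lemma reach_copy:
  assumes "w ! i \<noteq> 0" "i < length w" "0 \<notin> set a2"
  shows "reach (length a2 + 1) (cfg 0 w i v (a1 @ a2) (int (length a1)))
    (cfg 1 w i (v @ a2 @ [3]) (a1 @ a2) (int (length (a1 @ a2)) - 1))"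
  using assms(3)
proof (induction a2 arbitrary: a1 v)
  case Nil
  have "step sched_tm (cfg 0 w i v a1 (int (length a1))) =
      cfg 1 w i (v @ [3]) a1 (int (length a1) - 1)"
    using assms(1,2) by (simp add: step_simps contents_def[of w])
  then show ?case
    unfolding append_Nil2 append_Nil by (rule reach_step) (auto intro: reach_refl)
next
  case (Cons s a2)
  have "step sched_tm (cfg 0 w i v (a1 @ s # a2) (int (length a1))) =
      cfg 0 w i (v @ [s]) (a1 @ s # a2) (int (length (a1 @ [s])))"
    using assms(1,2) Cons.prems by (simp add: step_simps contents_def[of w] add.commute)
  moreover have "reach (length a2 + 1)
      (cfg 0 w i (v @ [s]) (a1 @ s # a2) (int (length (a1 @ [s]))))
      (cfg 1 w i (v @ (s # a2) @ [3]) (a1 @ s # a2) (int (length (a1 @ s # a2)) - 1))"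
    using Cons.IH[of "v @ [s]" "a1 @ [s]"] Cons.prems by simp
  ultimately show ?case
    by (rule reach_step) simp
qed

section \<open>Binary addition with carry\<close>

lemma add_carry_div:
  "(x + y + c) div 2 = x div 2 + y div 2 + (x mod 2 + y mod 2 + c) div (2::nat)"
proof -
  have "x + y + c = (x mod 2 + y mod 2 + c) + 2 * (x div 2 + y div 2)"
    by simp
  then show ?thesis
    by (metis add.commute div_mult_self2 zero_neq_numeral)
qed

lemma add_carry_mod: "(x mod 2 + y mod 2 + c) mod 2 = (x + y + c) mod (2::nat)"
  by (intro mod_add_cong) simp_all

text \<open>The first hypothesis excludes the case that ends the addition: the end symbol is scanned
  and no carry is left. If \<open>x = 0\<close> with a carry pending, the input head waits on the
  end symbol, which counts as the digit 0.\<close>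

lemma step_add:
  assumes "0 < x \<or> 0 < c" "c \<le> 1"
  shows "step sched_tm (cfg (2 + c) (w @ enc_num x @ w') (length w) v (u @ enc_bits y) (int (length u))) =
    cfg (2 + (x mod 2 + y mod 2 + c) div 2) (w @ enc_num x @ w')
      (length w + (if x = 0 then 0 else 1)) v
      (u @ [Suc ((x + y + c) mod 2)] @ enc_bits (y div 2)) (int (length u) + 1)"
proof -
  define w1 where "w1 = w @ enc_num x @ w'"
  have x: "contents w1 (int (length w)) = (if x = 0 then 3 else Suc (x mod 2))"
    by (simp add: w1_def enc_num_def enc_bits_pos)
  have y: "contents (u @ enc_bits y) (int (length u)) = (if y = 0 then 0 else Suc (y mod 2))"
    by (simp add: enc_bits_pos)
  \<comment> \<open>For \<open>y = 0\<close> the write extends the word, otherwise it replaces the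
    lowest digit of \<open>y\<close>.\<close>
  have upd: "(contents (u @ enc_bits y))(int (length u) := b) = contents (u @ [b] @ enc_bits (y div 2))" for b
    by (cases "y = 0") (simp_all add: enc_bits_pos)
  have "Suc (x mod 2) \<noteq> 3" "Suc (x mod 2) \<noteq> 4"
    by presburger+
  then show ?thesis
    using assms unfolding w1_def[symmetric]
    by (auto simp: step_simps x y upd simp flip: add_carry_mod[of x y c])
qed

text \<open>The digits already written are \<open>u\<close>. Each step produces one more and halves
  the rest \<open>x + y + c\<close>, which is the induction measure. Adding stops once
  \<open>x\<close> and the carry are used up, with the higher digits of \<open>y\<close> left in
  place, so the final head position \<open>j\<close> is only bounded.\<close>

lemma reach_add:
  assumes "c \<le> 1"
  shows "\<exists>j\<le>length u + length (enc_bits (x + y + c)).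
    reach (length (enc_bits (x + y + c)))
      (cfg (2 + c) (w @ enc_num x @ w') (length w) v (u @ enc_bits y) (int (length u)))
      (cfg 2 (w @ enc_num x @ w') (length (w @ enc_bits x)) v (u @ enc_bits (x + y + c)) (int j))"
  using assms
proof (induction "x + y + c" arbitrary: x y c u w rule: less_induct)
  case less
  show ?case
  proof (cases "x = 0 \<and> c = 0")
    case True
    then show ?thesis
      by (auto intro!: exI[of _ "length u"] reach_refl)
  next
    case False
    define c' where "c' = (x mod 2 + y mod 2 + c) div 2"
    define b where "b = Suc ((x + y + c) mod 2)"
    define z where "z = x div 2 + y div 2 + c'"
    have z: "z = (x + y + c) div 2"
      unfolding z_def c'_def by (rule add_carry_div[symmetric])
    have enc: "enc_bits (x + y + c) = b # enc_bits z"
      using False unfolding z b_def by (intro enc_bits_pos) auto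
    have "z < x + y + c" "c' \<le> 1"
      using False less.prems unfolding z c'_def by (auto simp: div_less_dividend)
    \<comment> \<open>The part of the input already read grows only while digits of \<open>x\<close>
      remain.\<close>
    define w1 where "w1 = (if x = 0 then w else w @ [Suc (x mod 2)])"
    have w1: "w @ enc_num x @ w' = w1 @ enc_num (x div 2) @ w'"
      "w @ enc_bits x = w1 @ enc_bits (x div 2)"
      "length w + (if x = 0 then 0 else 1) = length w1"
      by (auto simp: w1_def enc_num_def enc_bits_pos)
    obtain j where j: "j \<le> length (u @ [b]) + length (enc_bits z)"
      and r: "reach (length (enc_bits z))
        (cfg (2 + c') (w1 @ enc_num (x div 2) @ w') (length w1) v
          ((u @ [b]) @ enc_bits (y div 2)) (int (length (u @ [b]))))
        (cfg 2 (w1 @ enc_num (x div 2) @ w') (length (w1 @ enc_bits (x div 2))) v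
          ((u @ [b]) @ enc_bits z) (int j))"
      using less.hyps[of "x div 2" "y div 2" c' "u @ [b]" w1] \<open>z < x + y + c\<close> \<open>c' \<le> 1\<close>
      unfolding z_def by blast
    have "step sched_tm (cfg (2 + c) (w @ enc_num x @ w') (length w) v
          (u @ enc_bits y) (int (length u))) =
        cfg (2 + c') (w1 @ enc_num (x div 2) @ w') (length w1) v
          ((u @ [b]) @ enc_bits (y div 2)) (int (length (u @ [b])))"
      using step_add[of x c w w' v u y] False less.prems
      unfolding w1 c'_def[symmetric] b_def[symmetric] by (simp add: add.commute)
    then have "reach (Suc (length (enc_bits z)))
        (cfg (2 + c) (w @ enc_num x @ w') (length w) v (u @ enc_bits y) (int (length u)))
        (cfg 2 (w1 @ enc_num (x div 2) @ w') (length (w1 @ enc_bits (x div 2))) v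
          ((u @ [b]) @ enc_bits z) (int j))"
      using r by (rule reach_step) simp
    then show ?thesis
      using j unfolding enc w1(1,2) by (intro exI[of _ j]) simp
  qed
qed

section \<open>Processing of numbers, tasks and instances\<close>

lemma zero_notin_enc_bits: "0 \<notin> set (enc_bits n)"
  using set_enc_bits[of n] by auto

text \<open>At most \<open>N\<close> steps go into the addition, one passes the end symbol, and at
  most \<open>N + 1\<close> rewind.\<close>

lemma reach_number:
  assumes "length (enc_bits (x + y)) \<le> N"
  shows "reach (2 * N + 2)
    (cfg 2 (w @ enc_num x @ w') (length w) v (enc_bits y) 0)
    (cfg 2 (w @ enc_num x @ w') (length (w @ enc_num x)) v (enc_bits (x + y)) 0)"
proof -
  let ?w = "w @ enc_num x @ w'"
  obtain j where j: "j \<le> length (enc_bits (x + y))"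
    and r: "reach (length (enc_bits (x + y)))
      (cfg 2 ?w (length w) v (enc_bits y) 0)
      (cfg 2 ?w (length (w @ enc_bits x)) v (enc_bits (x + y)) (int j))"
    using reach_add[of 0 "[]" x y w w' v] by auto
  have "contents ?w (int (length (w @ enc_bits x))) = 3"
    using contents_nth[of "w @ enc_bits x" 3 w'] by (simp add: enc_num_def)
  then have "step sched_tm (cfg 2 ?w (length (w @ enc_bits x)) v (enc_bits (x + y)) (int j)) =
      cfg 1 ?w (length (w @ enc_num x)) v (enc_bits (x + y)) (int j - 1)"
    by (simp add: step_simps enc_num_def)
  then have "reach (j + 2) (cfg 2 ?w (length (w @ enc_bits x)) v (enc_bits (x + y)) (int j))
      (cfg 2 ?w (length (w @ enc_num x)) v (enc_bits (x + y)) 0)"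
    using reach_rewind[OF zero_notin_enc_bits j] by (rule reach_step) simp
  with r show ?thesis
    by (rule reach_trans) (use j assms in simp)
qed

text \<open>A bound \<open>N\<close> on the final accumulator also bounds all earlier ones, since
  partial sums only grow.\<close>

lemma reach_numbers:
  assumes "length (enc_bits (y + sum_list xs)) \<le> N"
  shows "reach ((2 * N + 2) * length xs)
    (cfg 2 (w @ concat (map enc_num xs) @ w') (length w) v (enc_bits y) 0)
    (cfg 2 (w @ concat (map enc_num xs) @ w') (length (w @ concat (map enc_num xs))) v
      (enc_bits (y + sum_list xs)) 0)"
  using assms
proof (induction xs arbitrary: w y)
  case Nil
  then show ?case by (simp add: reach_refl)
next
  case (Cons x xs)
  let ?w = "w @ enc_num x @ concat (map enc_num xs) @ w'"
  have "length (enc_bits (x + y)) \<le> N"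
    using Cons.prems length_enc_bits_mono[of "x + y" "y + sum_list (x # xs)"] by simp
  then have "reach (2 * N + 2) (cfg 2 ?w (length w) v (enc_bits y) 0)
      (cfg 2 ?w (length (w @ enc_num x)) v (enc_bits (x + y)) 0)"
    by (rule reach_number)
  moreover have "reach ((2 * N + 2) * length xs)
      (cfg 2 ?w (length (w @ enc_num x)) v (enc_bits (x + y)) 0)
      (cfg 2 ?w (length (w @ enc_num x @ concat (map enc_num xs))) v
        (enc_bits (y + sum_list (x # xs))) 0)"
    using Cons.IH[of "x + y" "w @ enc_num x"] Cons.prems by (simp add: ac_simps)
  ultimately have "reach ((2 * N + 2) * length (x # xs)) (cfg 2 ?w (length w) v (enc_bits y) 0)
      (cfg 2 ?w (length (w @ enc_num x @ concat (map enc_num xs))) v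
        (enc_bits (y + sum_list (x # xs))) 0)"
    by (rule reach_trans) simp
  then show ?case by simp
qed

text \<open>Every number has at least its end symbol. This converts a cost per number into a cost
  per symbol.\<close>

lemma length_le_length_concat_enc_num: "length xs \<le> length (concat (map enc_num xs))"
  by (induction xs) (simp_all add: enc_num_def)

lemma reach_task:
  assumes "length (enc_bits (y + dur T)) \<le> N"
  shows "reach ((2 * N + 3) * length (enc_task T))
    (cfg 0 (w @ enc_task T @ w') (length w) v (enc_bits y) 0)
    (cfg 0 (w @ enc_task T @ w') (length (w @ enc_task T)) (v @ enc_num y)
      (enc_bits (y + dur T)) 0)"
proof -
  let ?xs = "crit T # snd T"
  let ?e = "concat (map enc_num ?xs)"
  let ?w = "w @ enc_task T @ w'"
  have w: "?w = w @ ?e @ 4 # w'"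
    by (simp add: enc_task_def)
  have y: "length (enc_bits y) \<le> N"
    using assms length_enc_bits_mono[of y "y + dur T"] by simp
  \<comment> \<open>The input head is on a nonblank symbol, so state 0 copies and does not
    halt.\<close>
  have "?w ! length w \<in> set (enc_task T)"
    by (simp add: nth_append enc_task_def enc_num_def)
  then have "?w ! length w \<noteq> 0" "length w < length ?w"
    using set_enc_instance[of "[T]"] by (auto simp: enc_instance_def enc_task_def)
  then have "reach (N + 1) (cfg 0 ?w (length w) v (enc_bits y) 0)
      (cfg 1 ?w (length w) (v @ enc_num y) (enc_bits y) (int (length (enc_bits y)) - 1))"
    using reach_copy[of ?w "length w" "enc_bits y" v "[]"] zero_notin_enc_bits[of y] y
    by (simp add: enc_num_def reach_mono)
  moreover have "reach (N + 1)
      (cfg 1 ?w (length w) (v @ enc_num y) (enc_bits y) (int (length (enc_bits y)) - 1))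
      (cfg 2 ?w (length w) (v @ enc_num y) (enc_bits y) 0)"
    by (rule reach_mono[OF reach_rewind[OF zero_notin_enc_bits order_refl]]) (use y in simp)
  ultimately have copy: "reach (2 * N + 2) (cfg 0 ?w (length w) v (enc_bits y) 0)
      (cfg 2 ?w (length w) (v @ enc_num y) (enc_bits y) 0)"
    by (rule reach_trans) simp
  have add: "reach ((2 * N + 2) * length ?xs)
      (cfg 2 ?w (length w) (v @ enc_num y) (enc_bits y) 0)
      (cfg 2 ?w (length (w @ ?e)) (v @ enc_num y) (enc_bits (y + dur T)) 0)"
    unfolding w dur_def by (rule reach_numbers) (use assms in \<open>simp add: dur_def\<close>)
  have "contents ?w (int (length (w @ ?e))) = 4"
    unfolding w using contents_nth[of "w @ ?e" 4 w'] by simp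
  then have "step sched_tm (cfg 2 ?w (length (w @ ?e)) (v @ enc_num y) (enc_bits (y + dur T)) 0) =
      cfg 0 ?w (length (w @ enc_task T)) (v @ enc_num y) (enc_bits (y + dur T)) 0"
    by (simp add: step_simps enc_task_def)
  then have "reach 1 (cfg 2 ?w (length (w @ ?e)) (v @ enc_num y) (enc_bits (y + dur T)) 0)
      (cfg 0 ?w (length (w @ enc_task T)) (v @ enc_num y) (enc_bits (y + dur T)) 0)"
    by (rule reach_step) (auto intro: reach_refl)
  with add have "reach ((2 * N + 2) * length ?xs + 1)
      (cfg 2 ?w (length w) (v @ enc_num y) (enc_bits y) 0)
      (cfg 0 ?w (length (w @ enc_task T)) (v @ enc_num y) (enc_bits (y + dur T)) 0)"
    by (rule reach_trans) simp
  \<comment> \<open>Copying and rewinding cost as much as one number, and passing the symbol 4 takes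
    one more step. Because of this 4 a task has more symbols than numbers, so
    \<open>2 * N + 3\<close> steps per symbol suffice.\<close>
  moreover have "2 * N + 2 + ((2 * N + 2) * length ?xs + 1) \<le> (2 * N + 3) * length (enc_task T)"
  proof -
    have "Suc (length ?xs) \<le> length (enc_task T)"
      using length_le_length_concat_enc_num[of ?xs] by (simp add: enc_task_def)
    then have "(2 * N + 3) * Suc (length ?xs) \<le> (2 * N + 3) * length (enc_task T)"
      by (rule mult_le_mono2)
    then show ?thesis by (simp add: algebra_simps)
  qed
  ultimately show ?thesis
    using reach_trans[OF copy] by blast
qed

text \<open>Only the output matters on halting, so the words on the other tapes are left
  existential. The extra step meets the blank behind the input and halts.\<close>

lemma reach_instance:
  assumes "length (enc_bits (y + sum_list (map dur I))) \<le> N"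
  shows "\<exists>w'' i a. reach ((2 * N + 3) * length (enc_instance I) + 1)
    (cfg 0 (w @ enc_instance I) (length w) v (enc_bits y) 0)
    (cfg 4 w'' i (v @ enc_schedule (starts y I)) a 0)"
  using assms
proof (induction I arbitrary: w v y)
  case Nil
  have "step sched_tm (cfg 0 w (length w) v (enc_bits y) 0) = cfg 4 w (length w) v (enc_bits y) 0"
    by (simp add: step_simps)
  then have "reach 1 (cfg 0 w (length w) v (enc_bits y) 0) (cfg 4 w (length w) v (enc_bits y) 0)"
    by (rule reach_step) (auto intro: reach_refl)
  then show ?case
    by (auto simp: enc_instance_def enc_schedule_def)
next
  case (Cons T I)
  have "length (enc_bits (y + dur T)) \<le> N"
    using Cons.prems length_enc_bits_mono[of "y + dur T" "y + sum_list (map dur (T # I))"] by simp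
  then have *: "reach ((2 * N + 3) * length (enc_task T))
    (cfg 0 (w @ enc_task T @ enc_instance I) (length w) v (enc_bits y) 0)
    (cfg 0 (w @ enc_task T @ enc_instance I) (length (w @ enc_task T)) (v @ enc_num y)
      (enc_bits (y + dur T)) 0)"
    by (rule reach_task)
  obtain w'' i a where "reach ((2 * N + 3) * length (enc_instance I) + 1)
      (cfg 0 (w @ enc_task T @ enc_instance I) (length (w @ enc_task T)) (v @ enc_num y)
        (enc_bits (y + dur T)) 0)
      (cfg 4 w'' i (v @ enc_schedule (starts y (T # I))) a 0)"
    using Cons.IH[of "y + dur T" "w @ enc_task T" "v @ enc_num y"] Cons.prems
    by (auto simp: enc_schedule_def add.assoc)
  with * have "reach ((2 * N + 3) * (length (enc_task T) + length (enc_instance I)) + 1)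
      (cfg 0 (w @ enc_task T @ enc_instance I) (length w) v (enc_bits y) 0)
      (cfg 4 w'' i (v @ enc_schedule (starts y (T # I))) a 0)"
    by (rule reach_trans) (simp add: algebra_simps)
  moreover have "enc_instance (T # I) = enc_task T @ enc_instance I"
    by (simp add: enc_instance_def)
  ultimately show ?case by (intro exI) simp
qed

lemma poly_time_starts: "poly_time_on D enc_instance enc_schedule (starts 0)"
proof -
  \<comment> \<open>These are the coefficients of \<open>(2 * n + 3) * n + 1\<close>, the bound of
    \<open>reach_instance\<close> with \<open>N = n\<close>.\<close>
  let ?p = "[:1, 3, 2:] :: nat poly"
  have "{1, 2, 3, 4} \<subseteq> {..<num_symbols sched_tm}"
    by (simp add: sched_tm_def)
  then have "set (enc_instance I) \<subseteq> {..<num_symbols sched_tm}" for I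
    using set_enc_instance by (rule order_trans[rotated])
  moreover have "outputs_within sched_tm (enc_instance I) (poly ?p (length (enc_instance I)))
      (enc_schedule (starts 0 I))" for I
  proof -
    define n where "n = length (enc_instance I)"
    have "length (enc_bits (0 + sum_list (map dur I))) \<le> n"
      using length_enc_bits_sum_dur[of I] by (simp add: n_def)
    from reach_instance[OF this, of "[]" "[]"] obtain w i a where
      "reach ((2 * n + 3) * n + 1)
        (cfg 0 (enc_instance I) 0 [] [] 0) (cfg 4 w i (enc_schedule (starts 0 I)) a 0)"
      unfolding n_def append_Nil enc_bits_0 list.size by blast
    then obtain t where t: "t \<le> (2 * n + 3) * n + 1"
      "(step sched_tm ^^ t) (cfg 0 (enc_instance I) 0 [] [] 0) =
        cfg 4 w i (enc_schedule (starts 0 I)) a 0"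
      unfolding reach_def by blast
    \<comment> \<open>The blank third tape encodes 0, the start time of the first task.\<close>
    have "init sched_tm (enc_instance I) = cfg 0 (enc_instance I) 0 [] [] 0"
      by (simp add: init_def cfg_def sched_tm_def contents_Nil numeral_eq_Suc)
    moreover have "poly ?p n = (2 * n + 3) * n + 1"
      by (simp add: algebra_simps)
    moreover have "num_states sched_tm = 4"
      by (simp add: sched_tm_def)
    ultimately show ?thesis
      unfolding outputs_within_def n_def[symmetric]
      using t by (intro exI[of _ t]) (auto simp: cfg_def algebra_simps simp del: step.simps)
  qed
  ultimately show ?thesis
    unfolding poly_time_on_def using wf_sched_tm by blast
qed

section \<open>Approximation within a constant factor\<close>

theorem proposition1:
  fixes L :: nat
  assumes "1 \<le> L"
  shows "\<exists>c::real. 1 \<le> c \<and>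
    (\<exists>A :: task list \<Rightarrow> schedule.
       poly_time_on (instances L) enc_instance enc_schedule A \<and>
       (\<forall>I\<in>instances L.
          feasible I (A I) \<and> real (makespan I (A I)) \<le> c * real (OPT I)))"
proof (intro exI[of _ "real (2 * L * L)"] exI[of _ "starts 0"] conjI ballI)
  have "1 \<le> 2 * L * L"
    using assms by simp
  then show "1 \<le> real (2 * L * L)"
    by linarith
  show "poly_time_on (instances L) enc_instance enc_schedule (starts 0)"
    by (rule poly_time_starts)
  fix I
  assume I: "I \<in> instances L"
  show "feasible I (starts 0 I)"
    by (rule feasible_starts[OF I])
  show "real (makespan I (starts 0 I)) \<le> real (2 * L * L) * real (OPT I)"
    using makespan_starts_le_OPT[OF I] by (metis of_nat_le_iff of_nat_mult)
qed

end
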